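(* Let $(X,d,p,\sigma)$ be a power distance space with $(p,\sigma)\in(\mathbb{R}^*\setminus\{0\})\times\mathbb{R}^+$, and let $(\mathbb{R},q)$ be the metric space of real numbers with the usual metric $q(x,y)=|x-y|$. If $2\sigma=2^{1/p}$, then $d$ is continuous as a function with values in $(\mathbb{R},q)$; that is, whenever $(x_n)$ and $(y_n)$ are sequences in $X$ converging in $(X,d)$ to $x$ and $y$ respectively, $\lim_{n\to\infty}d(x_n,y_n)=d(x,y)$.
   Context: A distance on a set $X$ is a function $d:X\times X\to\mathbb{R}$ such that for all $x,y\in X$: $d(x,y)\ge 0$; $d(x,y)=0\iff x=y$; $d(x,y)=d(y,x)$. The pair $(X,d)$ is then a distance space. A sequence $(x_n)$ converges to $x\in X$ in $(X,d)$ if for every real $\varepsilon>0$ there is $N$ such that $d(x_n,x)<\varepsilon$ for all $n>N$. $\mathbb{R}^*=\mathbb{R}\cup\{-\infty,\infty\}$, $\mathbb{R}^+$ is the set of positive reals, and $2^{1/p}=1$ for $p=\pm\infty$. The power triangle function is $\tau(p,\sigma;x,y,z;d)=2\sigma\left[\tfrac12 d^p(x,z)+\tfrac12 d^p(z,y)\right]^{1/p}$, where for $p=\infty,0,-\infty$ it is interpreted by its limit in $p$, namely $2\sigma\max\{d(x,z),d(z,y)\}$, $2\sigma\sqrt{d(x,z)}\sqrt{d(z,y)}$, $2\sigma\min\{d(x,z),d(z,y)\}$ respectively, and for $p<0$ with $d(x,z)=0$ or $d(z,y)=0$ it is read as its limiting value $0$. The tuple $(X,d,p,\sigma)$, with $(p,\sigma)\in\mathbb{R}^*\times\mathbb{R}^+$,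 is a power distance space if $(X,d)$ is a distance space and $d(x,y)\le\tau(p,\sigma;x,y,z;d)$ for all $x,y,z\in X$. *)

theory Defs
  imports Complex_Main "HOL-Library.Extended_Real"
begin

definition distance_space :: "'a set \<Rightarrow> ('a \<Rightarrow> 'a \<Rightarrow> real) \<Rightarrow> bool" where
  "distance_space X d \<longleftrightarrow>
     (\<forall>x\<in>X. \<forall>y\<in>X. d x y \<ge> 0 \<and> (d x y = 0 \<longleftrightarrow> x = y) \<and> d x y = d y x)"

definition converges_in ::
    "'a set \<Rightarrow> ('a \<Rightarrow> 'a \<Rightarrow> real) \<Rightarrow> (nat \<Rightarrow> 'a) \<Rightarrow> 'a \<Rightarrow> bool" where
  "converges_in X d s x \<longleftrightarrow>
     (\<forall>n. s n \<in> X) \<and> x \<in> X \<and> (\<forall>\<epsilon>>0. \<exists>N. \<forall>n>N. d (s n) x < \<epsilon>)"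

text \<open>
  The values at \<open>p = \<infinity>, 0, -\<infinity>\<close>, and at \<open>p < 0\<close> when one of the two distances vanishes, are
  the limiting ones. The last case needs its own clause because \<open>0 powr r = 0\<close> for negative
  \<open>r\<close> too; for \<open>r > 0\<close> it gives the intended value of the formula.
\<close>

definition power_triangle ::
    "ereal \<Rightarrow> real \<Rightarrow> 'a \<Rightarrow> 'a \<Rightarrow> 'a \<Rightarrow> ('a \<Rightarrow> 'a \<Rightarrow> real) \<Rightarrow> real" where
  "power_triangle p \<sigma> x y z d =
     (case p of
        ereal r \<Rightarrow>
          (if r = 0 then 2 * \<sigma> * sqrt (d x z) * sqrt (d z y)
           else if r < 0 \<and> (d x z = 0 \<or> d z y = 0) then 0
           else 2 * \<sigma> * ((1/2) * d x z powr r + (1/2) * d z y powr r) powr (1 / r))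
      | PInfty \<Rightarrow> 2 * \<sigma> * max (d x z) (d z y)
      | MInfty \<Rightarrow> 2 * \<sigma> * min (d x z) (d z y))"

definition power_distance_space ::
    "'a set \<Rightarrow> ('a \<Rightarrow> 'a \<Rightarrow> real) \<Rightarrow> ereal \<Rightarrow> real \<Rightarrow> bool" where
  "power_distance_space X d p \<sigma> \<longleftrightarrow>
     distance_space X d \<and> \<sigma> > 0 \<and>
     (\<forall>x\<in>X. \<forall>y\<in>X. \<forall>z\<in>X. d x y \<le> power_triangle p \<sigma> x y z d)"

text \<open>\<open>2^(1/p)\<close> for extended real \<open>p\<close>, meaningful for \<open>p \<noteq> 0\<close> only.\<close>

definition two_root :: "ereal \<Rightarrow> real" where
  "two_root p = (case p of ereal r \<Rightarrow> 2 powr (1 / r) | PInfty \<Rightarrow> 1 | MInfty \<Rightarrow> 1)"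

end

theory Submission
  imports Defs
begin

text \<open>
  For \<open>p > 0\<close> the hypothesis \<open>2\<sigma> = 2^(1/p)\<close> says exactly that \<open>d^p\<close> (or \<open>d\<close> itself if \<open>p = \<infinity>\<close>)
  satisfies the ordinary triangle inequality. For \<open>p < 0\<close> the power triangle inequality through
  \<open>z = x\<close> forces \<open>d x y = 0\<close>, so \<open>X\<close> has at most one point. In all cases some positive power of
  \<open>d\<close> is a metric; metrics are continuous, and so is taking roots.
\<close>

lemma converges_in_tendsto_0:
  assumes "distance_space X d" "converges_in X d s x"
  shows "(\<lambda>n. d (s n) x) \<longlonglongrightarrow> 0"
proof (rule LIMSEQ_I)
  fix \<epsilon> :: real
  assume "\<epsilon> > 0"
  then obtain N where N: "\<forall>n>N. d (s n) x < \<epsilon>"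
    using assms(2) unfolding converges_in_def by blast
  have nonneg: "d (s n) x \<ge> 0" for n
    using assms unfolding distance_space_def converges_in_def by blast
  show "\<exists>N. \<forall>n\<ge>N. norm (d (s n) x - 0) < \<epsilon>"
    using N nonneg by (intro exI[of _ "Suc N"]) auto
qed

text \<open>This is the usual proof that a metric is continuous, run for \<open>d\<close> to the
  power \<open>r\<close>: the quadrilateral inequality bounds the change of the power, and the
  \<open>r\<close>-th root carries the limit back to \<open>d\<close>.\<close>

lemma tendsto_of_triangle_powr:
  assumes dist: "distance_space X d" and r: "r > 0"
    and tri: "\<And>x y z. x \<in> X \<Longrightarrow> y \<in> X \<Longrightarrow> z \<in> X \<Longrightarrow>
      d x y powr r \<le> d x z powr r + d z y powr r"
    and xs: "converges_in X d xs x" and ys: "converges_in X d ys y"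
  shows "(\<lambda>n. d (xs n) (ys n)) \<longlonglongrightarrow> d x y"
proof -
  have in_X: "xs n \<in> X" "ys n \<in> X" "x \<in> X" "y \<in> X" for n
    using xs ys by (auto simp: converges_in_def)
  have nonneg: "d u v \<ge> 0" and sym: "d u v = d v u" if "u \<in> X" "v \<in> X" for u v
    using dist that by (auto simp: distance_space_def)
  have powr_0: "(\<lambda>n. d (s n) a powr r) \<longlonglongrightarrow> 0" if "converges_in X d s a" for s a
    using tendsto_powr'[OF converges_in_tendsto_0[OF dist that] tendsto_const[of r]] r that nonneg
    by (simp add: converges_in_def)
  have bound: "norm (d (xs n) (ys n) powr r - d x y powr r)
      \<le> d (xs n) x powr r + d (ys n) y powr r" for n
    \<comment> \<open>The first two instances go from \<open>xs n\<close> to \<open>ys n\<close> by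
      way of \<open>x\<close> and \<open>y\<close>; the other two go from \<open>x\<close> to
      \<open>y\<close> by way of \<open>xs n\<close> and \<open>ys n\<close>.\<close>
    using tri[OF in_X(1)[of n] in_X(2)[of n] in_X(3)] tri[OF in_X(3) in_X(2)[of n] in_X(4)]
      tri[OF in_X(3,4) in_X(1)[of n]] tri[OF in_X(1)[of n] in_X(4) in_X(2)[of n]]
    unfolding real_norm_def sym[OF in_X(3) in_X(1)[of n]] sym[OF in_X(4) in_X(2)[of n]]
    by linarith
  have "(\<lambda>n. d (xs n) (ys n) powr r - d x y powr r) \<longlonglongrightarrow> 0"
  proof (rule tendsto_0_le[where K = 1])
    show "(\<lambda>n. d (xs n) x powr r + d (ys n) y powr r) \<longlonglongrightarrow> 0"
      using tendsto_add[OF powr_0[OF xs] powr_0[OF ys]] by simp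
    show "\<forall>\<^sub>F n in sequentially. norm (d (xs n) (ys n) powr r - d x y powr r)
        \<le> norm (d (xs n) x powr r + d (ys n) y powr r) * 1"
      using order_trans[OF bound abs_ge_self] by simp
  qed
  then have "(\<lambda>n. d (xs n) (ys n) powr r) \<longlonglongrightarrow> d x y powr r"
    by (rule LIM_zero_cancel)
  \<comment> \<open>The limit may be 0, where continuity of the root relies on nonnegative terms and
    the positive exponent \<open>1 / r\<close>.\<close>
  then have "(\<lambda>n. (d (xs n) (ys n) powr r) powr (1 / r)) \<longlonglongrightarrow> (d x y powr r) powr (1 / r)"
    by (rule tendsto_powr'[OF _ tendsto_const]) (use r in auto)
  then show ?thesis
    using r in_X nonneg by (simp add: powr_powr)
qed

text \<open>The witness is \<open>r = p\<close> for finite positive \<open>p\<close>, and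
  \<open>r = 1\<close> otherwise.\<close>

lemma power_distance_space_triangle_powr:
  assumes pds: "power_distance_space X d p \<sigma>" and "p \<noteq> 0" and \<sigma>: "2 * \<sigma> = two_root p"
  obtains r where "r > 0"
    "\<And>x y z. x \<in> X \<Longrightarrow> y \<in> X \<Longrightarrow> z \<in> X \<Longrightarrow>
      d x y powr r \<le> d x z powr r + d z y powr r"
proof -
  have nonneg: "d u v \<ge> 0" and self: "d u u = 0" if "u \<in> X" "v \<in> X" for u v
    using pds that by (auto simp: power_distance_space_def distance_space_def)
  have tri: "d x y \<le> power_triangle p \<sigma> x y z d" if "x \<in> X" "y \<in> X" "z \<in> X" for x y z
    using pds that by (auto simp: power_distance_space_def)
  consider s where "p = ereal s" "s > 0" | "p = \<infinity>" | "p < 0"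
    using \<open>p \<noteq> 0\<close> by (cases p) (auto simp: zero_ereal_def neq_iff)
  then show thesis
  proof cases
    case (1 s)
    have "d x y powr s \<le> d x z powr s + d z y powr s" if "x \<in> X" "y \<in> X" "z \<in> X" for x y z
    proof -
      have "d x y \<le> 2 powr (1 / s) * (1/2 * d x z powr s + 1/2 * d z y powr s) powr (1 / s)"
        using tri[OF that] 1 \<sigma> by (simp add: power_triangle_def two_root_def)
      \<comment> \<open>The factor 2 moves under the root and cancels both halves of the power
        mean.\<close>
      also have "\<dots> = (d x z powr s + d z y powr s) powr (1 / s)"
        by (subst powr_mult[symmetric]) (auto simp: distrib_left)
      finally have "d x y powr s \<le> ((d x z powr s + d z y powr s) powr (1 / s)) powr s"
        using 1 nonneg that by (intro powr_mono2) auto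
      then show ?thesis
        using 1 by (simp add: powr_powr)
    qed
    then show thesis
      using that 1 by blast
  next
    case 2
    have "d x y \<le> d x z + d z y" if "x \<in> X" "y \<in> X" "z \<in> X" for x y z
      \<comment> \<open>Here \<open>2 * \<sigma> = 1\<close>, and the maximum of two nonnegative
        numbers is at most their sum.\<close>
      using tri[OF that] 2 \<sigma> nonneg[of x z] nonneg[of z y] that
      by (simp add: power_triangle_def two_root_def)
    then show thesis
      using that[of 1] nonneg by simp
  next
    case 3
    have "d x y = 0" if "x \<in> X" "y \<in> X" for x y
      \<comment> \<open>With \<open>z = x\<close> one distance is \<open>d x x = 0\<close>, so the
        right-hand side is 0: by the limiting value for finite \<open>p\<close>, by the minimum for
        \<open>p = -\<infinity>\<close>.\<close>
      using tri[of x y x] 3 \<sigma> nonneg[OF that] self[OF that] that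
      by (cases p) (auto simp: power_triangle_def two_root_def zero_ereal_def)
    then show thesis
      using that[of 1] by simp
  qed
qed

theorem theorem4p18:
  fixes X :: "'a set" and d :: "'a \<Rightarrow> 'a \<Rightarrow> real" and p :: ereal and \<sigma> :: real
    and xs ys :: "nat \<Rightarrow> 'a" and x y :: 'a
  assumes "power_distance_space X d p \<sigma>"
    and "p \<noteq> 0"
    and "2 * \<sigma> = two_root p"
    and "converges_in X d xs x"
    and "converges_in X d ys y"
  shows "(\<lambda>n. d (xs n) (ys n)) \<longlonglongrightarrow> d x y"
proof -
  obtain r where r: "r > 0" and tri: "\<And>x y z. x \<in> X \<Longrightarrow> y \<in> X \<Longrightarrow> z \<in> X \<Longrightarrow>
      d x y powr r \<le> d x z powr r + d z y powr r"
    using power_distance_space_triangle_powr[OF assms(1-3)] by blast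
  have "distance_space X d"
    using assms(1) by (simp add: power_distance_space_def)
  then show ?thesis
    using r tri assms(4,5) by (rule tendsto_of_triangle_powr)
qed

end
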